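(* Let $q>0$ and $0<\theta_{ig}<\theta_{hl}$. Let $$Q_{+}=\Big\{(R,c) : R>0,\ c\geqslant\frac{qR}{\theta_{hl}}\Big\},$$ let $(\Delta)$ denote the line $c=\frac{qR}{\theta_{hl}}$, and for $(R,c)\in Q_+$ set $$G(R,c)=(e^{cR}-1-cR)\,q-c^2(\theta_{ig}e^{cR}-\theta_{hl}).$$ The following hold: (i) There exists a point $B_0=(R_0,c_0)\in Q_+$ lying on $(\Delta)$ and verifying $G(R_0,c_0)=0$, such that the level set $\{(R,c)\in Q_+ \mid G(R,c)=0\}$ is the graph of a smooth decreasing function $\varphi(R)$ defined on $(0,R_0]$. (ii) The curve $\varphi(R)$ has $B_0=(R_0,c_0)$ as endpoint at the right (so $\varphi(R_0)=c_0$), with left derivative $\varphi'(R_0^-)=0$, and has the axis $R=0$ as an asymptote at the left, i.e. $\varphi(R)\to+\infty$ as $R\to0^+$. *)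

theory Defs
  imports Complex_Main
begin

definition Q_plus :: "real \<Rightarrow> real \<Rightarrow> (real \<times> real) set" where
  "Q_plus q \<theta>hl = {(R, c). R > 0 \<and> c \<ge> q * R / \<theta>hl}"

definition line_Delta :: "real \<Rightarrow> real \<Rightarrow> (real \<times> real) set" where
  "line_Delta q \<theta>hl = {(R, c). c = q * R / \<theta>hl}"

definition G :: "real \<Rightarrow> real \<Rightarrow> real \<Rightarrow> real \<Rightarrow> real \<Rightarrow> real" where
  "G q \<theta>ig \<theta>hl R c =
     (exp (c * R) - 1 - c * R) * q - c\<^sup>2 * (\<theta>ig * exp (c * R) - \<theta>hl)"

text \<open>
  C-infinity on a set: the derivatives of all orders exist at every point of S, where they are
  taken within S. At an endpoint belonging to an interval S they are therefore one-sided.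
\<close>

definition smooth_on :: "real set \<Rightarrow> (real \<Rightarrow> real) \<Rightarrow> bool" where
  "smooth_on S f \<longleftrightarrow>
     (\<exists>D :: nat \<Rightarrow> real \<Rightarrow> real. D 0 = f \<and>
        (\<forall>n. \<forall>x\<in>S. (D n has_real_derivative D (Suc n) x) (at x within S)))"

end

theory Submission
  imports Defs
begin

text \<open>
  Along the level set the product \<open>x = c R\<close> is the right coordinate. Multiplying \<open>G = 0\<close> by
  \<open>R\<^sup>2\<close> turns it into \<open>R\<^sup>2 = P x\<close>, where
  \<open>P x = x\<^sup>2 (\<theta>ig e\<^sup>x - \<theta>hl) / (q (e\<^sup>x - 1 - x))\<close>: an equation in which \<open>R\<close> and \<open>x\<close> are
  separated. On \<open>x > 0\<close> the function \<open>P\<close> is strictly increasing (\<open>W_pos\<close>), so \<open>x\<close> is a smooth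
  function \<open>X\<close> of \<open>R\<close>, and the level set is the graph of \<open>\<phi> R = X R / R\<close>, cut off by the
  condition \<open>(R, c) \<in> Q_plus\<close>.

  Substituting \<open>R\<^sup>2 = P x\<close>, that condition becomes \<open>N x \<ge> 0\<close> with
  \<open>N x = \<theta>hl (e\<^sup>x - 1) - \<theta>ig x e\<^sup>x\<close>. This function starts from \<open>N 0 = 0\<close>, increases and then
  decreases to negative values (\<open>N_sign\<close>), so the condition reads \<open>x \<le> x0\<close> for its only
  positive zero \<open>x0\<close>; the zero itself corresponds to the line \<open>c = q R / \<theta>hl\<close>. The same \<open>N\<close> governs the slope:
  \<open>\<phi>'\<close> is a negative multiple of \<open>N (X R)\<close> (\<open>curve_deriv\<close>). Hence \<open>\<phi>\<close> decreases strictly before the endpoint and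
  has slope \<open>0\<close> precisely where the curve meets the line. Finally \<open>P x > 0\<close> forces
  \<open>x > ln (\<theta>hl / \<theta>ig) > 0\<close>, so that \<open>\<phi> R = X R / R\<close> blows up at \<open>R = 0\<close>.

  For the derivatives of all orders, note that \<open>X'\<close> is a rational expression in \<open>R\<close>, \<open>X\<close>
  and \<open>exp X\<close>. The functions that are rational in these three are therefore closed under
  differentiation (\<open>rational_closure_has_derivative\<close>), and \<open>\<phi>\<close> is one of them.
\<close>

section \<open>Smoothness of rational expressions in closed systems of functions\<close>

inductive_set rational_closure :: "real set \<Rightarrow> (real \<Rightarrow> real) set \<Rightarrow> (real \<Rightarrow> real) set"
  for S gens where
  const: "(\<lambda>_. a) \<in> rational_closure S gens"
| gen: "f \<in> gens \<Longrightarrow> f \<in> rational_closure S gens"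
| add: "f \<in> rational_closure S gens \<Longrightarrow> g \<in> rational_closure S gens \<Longrightarrow>
    (\<lambda>x. f x + g x) \<in> rational_closure S gens"
| mult: "f \<in> rational_closure S gens \<Longrightarrow> g \<in> rational_closure S gens \<Longrightarrow>
    (\<lambda>x. f x * g x) \<in> rational_closure S gens"
| inverse: "f \<in> rational_closure S gens \<Longrightarrow> (\<And>x. x \<in> S \<Longrightarrow> f x \<noteq> 0) \<Longrightarrow>
    (\<lambda>x. inverse (f x)) \<in> rational_closure S gens"

lemma rational_closure_minus:
  assumes "f \<in> rational_closure S gens"
  shows "(\<lambda>x. - f x) \<in> rational_closure S gens"
  using rational_closure.mult[OF rational_closure.const[of "-1"] assms] by simp

lemma rational_closure_diff:
  assumes "f \<in> rational_closure S gens" and "g \<in> rational_closure S gens"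
  shows "(\<lambda>x. f x - g x) \<in> rational_closure S gens"
  using rational_closure.add[OF assms(1) rational_closure_minus[OF assms(2)]] by simp

lemma rational_closure_divide:
  assumes "f \<in> rational_closure S gens" and "g \<in> rational_closure S gens"
    and "\<And>x. x \<in> S \<Longrightarrow> g x \<noteq> 0"
  shows "(\<lambda>x. f x / g x) \<in> rational_closure S gens"
  using rational_closure.mult[OF assms(1) rational_closure.inverse[OF assms(2,3)]]
  by (simp add: divide_inverse)

lemmas rational_closure_intros =
  rational_closure.const rational_closure.add rational_closure.mult
  rational_closure_minus rational_closure_diff rational_closure_divide

lemma rational_closure_has_derivative:
  assumes gens: "\<And>g. g \<in> gens \<Longrightarrow> \<exists>g' \<in> rational_closure S gens.
      \<forall>x\<in>S. (g has_real_derivative g' x) (at x within S)"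
    and "f \<in> rational_closure S gens"
  shows "\<exists>f' \<in> rational_closure S gens. \<forall>x\<in>S. (f has_real_derivative f' x) (at x within S)"
  using assms(2)
proof induction
  case (const a)
  show ?case
    by (intro bexI[of _ "\<lambda>_. 0"] rational_closure.const) auto
next
  case (gen f)
  then show ?case by (rule gens)
next
  case (add f g)
  then obtain f' g' where
    "f' \<in> rational_closure S gens" "\<forall>x\<in>S. (f has_real_derivative f' x) (at x within S)"
    "g' \<in> rational_closure S gens" "\<forall>x\<in>S. (g has_real_derivative g' x) (at x within S)"
    by blast
  then show ?case
    by (intro bexI[of _ "\<lambda>x. f' x + g' x"] rational_closure.add)
       (auto intro!: derivative_eq_intros)
next
  case (mult f g)
  then obtain f' g' where
    "f' \<in> rational_closure S gens" "\<forall>x\<in>S. (f has_real_derivative f' x) (at x within S)"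
    "g' \<in> rational_closure S gens" "\<forall>x\<in>S. (g has_real_derivative g' x) (at x within S)"
    by blast
  with mult show ?case
    by (intro bexI[of _ "\<lambda>x. f' x * g x + f x * g' x"] rational_closure_intros)
       (auto intro!: derivative_eq_intros)
next
  case (inverse f)
  then obtain f' where
    "f' \<in> rational_closure S gens" "\<forall>x\<in>S. (f has_real_derivative f' x) (at x within S)"
    by blast
  with inverse show ?case
    by (intro bexI[of _ "\<lambda>x. - (inverse (f x) * f' x * inverse (f x))"] rational_closure_intros
        rational_closure.inverse)
       (auto intro!: DERIV_inverse')
qed

text \<open>
  A set of functions that is closed under differentiation consists of smooth functions, since
  differentiation can be iterated without leaving it.
\<close>

lemma rational_closure_smooth_on:
  assumes gens: "\<And>g. g \<in> gens \<Longrightarrow> \<exists>g' \<in> rational_closure S gens.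
      \<forall>x\<in>S. (g has_real_derivative g' x) (at x within S)"
    and f: "f \<in> rational_closure S gens"
  shows "smooth_on S f"
proof -
  have "\<forall>f \<in> rational_closure S gens. \<exists>f'. f' \<in> rational_closure S gens \<and>
      (\<forall>x\<in>S. (f has_real_derivative f' x) (at x within S))"
    using rational_closure_has_derivative[OF gens] by blast
  then obtain d where d: "\<forall>f \<in> rational_closure S gens. d f \<in> rational_closure S gens \<and>
      (\<forall>x\<in>S. (f has_real_derivative d f x) (at x within S))"
    by (rule bchoice[THEN exE])
  have "(d ^^ n) f \<in> rational_closure S gens" for n
    by (induction n) (use f d in auto)
  with d show ?thesis
    unfolding smooth_on_def by (intro exI[of _ "\<lambda>n. (d ^^ n) f"]) auto
qed

section \<open>Inverting an increasing function on the positive half-line\<close>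

lemma inv_into_positive_has_derivative:
  fixes f f' :: "real \<Rightarrow> real"
  assumes deriv: "\<And>x. 0 < x \<Longrightarrow> (f has_real_derivative f' x) (at x)"
    and pos: "\<And>x. 0 < x \<Longrightarrow> 0 < f' x"
    and x: "0 < x"
  shows "(inv_into {0<..} f has_real_derivative inverse (f' x)) (at (f x))"
proof -
  let ?g = "inv_into {0<..} f"
  have mono: "f u < f v" if "0 < u" "u < v" for u v
    using that by (intro DERIV_pos_imp_increasing[of u v f]) (auto intro!: exI deriv pos)
  have inj: "inj_on f {0<..}"
    by (rule linorder_inj_onI) (auto dest: mono)
  have left: "?g (f z) = z" if "0 < z" for z
    using inj that by (simp add: inv_into_f_f)
  have cont: "isCont f z" if "0 < z" for z
    using deriv[OF that] by (rule DERIV_isCont)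
  define u v where "u = x / 2" and "v = x + 1"
  have uv: "0 < u" "u < x" "x < v"
    using x by (auto simp: u_def v_def)
  show ?thesis
  proof (rule DERIV_inverse_function[where f = f and a = "f u" and b = "f v"])
    show "(f has_real_derivative f' x) (at (?g (f x)))"
      using deriv[OF x] left[OF x] by simp
    show "f' x \<noteq> 0"
      using pos[OF x] by simp
    show "f u < f x" "f x < f v"
      using mono uv x by auto
    show "isCont ?g (f x)"
      by (rule isCont_inverse_function2[of u x v]) (use uv left cont in auto)
    show "f (?g y) = y" if "f u < y" "y < f v" for y
    proof -
      have "\<exists>z\<ge>u. z \<le> v \<and> f z = y"
        by (rule IVT) (use that uv cont in auto)
      then show ?thesis
        using uv left by force
    qed
  qed
qed

section \<open>The level set in the coordinate \<open>x = c R\<close>\<close>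

locale ignition =
  fixes q ti th :: real
  assumes q_pos: "0 < q" and ti_pos: "0 < ti" and ti_less_th: "ti < th"
begin

definition A :: "real \<Rightarrow> real" where "A x = exp x - 1 - x"
definition B :: "real \<Rightarrow> real" where "B x = ti * exp x - th"

definition P :: "real \<Rightarrow> real" where "P x = x\<^sup>2 * B x / (q * A x)"

text \<open>
  This expression arises in two ways: as \<open>th * A x - x * B x\<close>, whose sign tells the side of the
  line, and as \<open>A x * B' x - A' x * B x\<close>, the numerator of the derivative of \<open>B / A\<close>.
\<close>
definition N :: "real \<Rightarrow> real" where "N x = th * (exp x - 1) - ti * x * exp x"

text \<open>Up to a positive factor, this is the derivative of \<open>P\<close>.\<close>
definition W :: "real \<Rightarrow> real" where "W x = 2 * A x * B x + x * N x"

lemma A_pos: "0 < x \<Longrightarrow> 0 < A x"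
  using exp_minus_greater[of "-x"] by (simp add: A_def)

text \<open>
  Sorting \<open>W x\<close> by its parameters shows its sign: the coefficients of \<open>ti\<close> and \<open>th\<close> are
  \<open>exp x * (2 * A x - x\<^sup>2)\<close> and \<open>(x - 2) * exp x + x + 2\<close>. Both \<open>2 * A x - x\<^sup>2\<close> and the second
  coefficient vanish at \<open>0\<close> and have a positive derivative for \<open>x > 0\<close>.
\<close>

lemma W_pos:
  assumes "0 < x"
  shows "0 < W x"
proof -
  have "2 * A 0 - 0\<^sup>2 < 2 * A x - x\<^sup>2"
  proof (rule DERIV_pos_imp_increasing_open[OF assms])
    fix t :: real assume "0 < t"
    have "((\<lambda>t. 2 * A t - t\<^sup>2) has_real_derivative 2 * A t) (at t)"
      unfolding A_def by (auto intro!: derivative_eq_intros)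
    then show "\<exists>y. ((\<lambda>t. 2 * A t - t\<^sup>2) has_real_derivative y) (at t) \<and> 0 < y"
      using A_pos[OF \<open>0 < t\<close>] by auto
  qed (auto simp: A_def intro!: continuous_intros)
  then have ti_coeff: "0 < 2 * A x - x\<^sup>2"
    by (simp add: A_def)
  have "(0 - 2) * exp 0 + 0 + 2 < (x - 2) * exp x + x + 2"
  proof (rule DERIV_pos_imp_increasing_open[OF assms])
    fix t :: real assume "0 < t"
    then have "1 - t < exp (- t)"
      by (simp add: exp_minus_greater)
    then have "(1 - t) * exp t < 1"
      by (simp add: exp_minus field_simps)
    moreover have "((\<lambda>t. (t - 2) * exp t + t + 2) has_real_derivative 1 - (1 - t) * exp t) (at t)"
      by (auto intro!: derivative_eq_intros simp: algebra_simps)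
    ultimately show "\<exists>y. ((\<lambda>t. (t - 2) * exp t + t + 2) has_real_derivative y) (at t) \<and> 0 < y"
      by (intro exI[of _ "1 - (1 - t) * exp t"]) auto
  qed (auto intro!: continuous_intros)
  then have th_coeff: "0 < (x - 2) * exp x + x + 2"
    by simp
  have "W x = ti * (exp x * (2 * A x - x\<^sup>2)) + th * ((x - 2) * exp x + x + 2)"
    by (simp add: W_def A_def B_def N_def algebra_simps power2_eq_square)
  moreover have "0 < ti * (exp x * (2 * A x - x\<^sup>2))"
    using ti_pos ti_coeff by simp
  moreover have "0 < th * ((x - 2) * exp x + x + 2)"
    using ti_pos ti_less_th th_coeff by simp
  ultimately show ?thesis by simp
qed

lemma P_deriv:
  assumes "0 < x"
  shows "(P has_real_derivative x * W x / (q * (A x)\<^sup>2)) (at x)"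
proof -
  have "A x \<noteq> 0"
    using A_pos[OF assms] by simp
  have dA: "(A has_real_derivative exp x - 1) (at x)"
    unfolding A_def[abs_def] by (auto intro!: derivative_eq_intros)
  have dB: "(B has_real_derivative ti * exp x) (at x)"
    unfolding B_def[abs_def] by (auto intro!: derivative_eq_intros)
  have "(P has_real_derivative
      ((2 * x * B x + ti * exp x * x\<^sup>2) * (q * A x) - x\<^sup>2 * B x * (q * (exp x - 1)))
        / (q * A x * (q * A x))) (at x)"
    unfolding P_def[abs_def] using q_pos \<open>A x \<noteq> 0\<close>
    by (auto intro!: derivative_eq_intros dA dB simp: algebra_simps)
  also have "(2 * x * B x + ti * exp x * x\<^sup>2) * (q * A x) - x\<^sup>2 * B x * (q * (exp x - 1))
      = q * (x * W x)"
    by (simp add: W_def N_def A_def B_def algebra_simps power2_eq_square)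
  finally show ?thesis
    using q_pos by (simp add: power2_eq_square mult_ac)
qed

lemma P_deriv_pos: "0 < x \<Longrightarrow> 0 < x * W x / (q * (A x)\<^sup>2)"
  using W_pos[of x] A_pos[of x] q_pos by simp

lemma P_less: "0 < x \<Longrightarrow> x < y \<Longrightarrow> P x < P y"
  by (rule DERIV_pos_imp_increasing[of x y P]) (auto intro!: exI P_deriv P_deriv_pos)

lemma P_inj: "inj_on P {0<..}"
  by (rule linorder_inj_onI) (auto dest: P_less)

lemma P_le_iff: "0 < x \<Longrightarrow> 0 < y \<Longrightarrow> P x \<le> P y \<longleftrightarrow> x \<le> y"
  using P_less[of x y] P_less[of y x] by (cases x y rule: linorder_cases) auto

lemma G_eq_0_iff:
  assumes "0 < R" and "0 < c"
  shows "G q ti th R c = 0 \<longleftrightarrow> P (c * R) = R\<^sup>2"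
proof -
  have "0 < A (c * R)"
    using assms by (intro A_pos) simp
  then have "P (c * R) = R\<^sup>2 \<longleftrightarrow> R\<^sup>2 * (c\<^sup>2 * B (c * R)) = R\<^sup>2 * (q * A (c * R))"
    using q_pos by (simp add: P_def power_mult_distrib field_simps)
  also have "\<dots> \<longleftrightarrow> c\<^sup>2 * B (c * R) = q * A (c * R)"
    using assms by simp
  also have "\<dots> \<longleftrightarrow> G q ti th R c = 0"
    by (auto simp: G_def A_def B_def algebra_simps)
  finally show ?thesis ..
qed

text \<open>
  On the level set, \<open>c - q * R / th\<close> is a positive multiple of \<open>N (c * R)\<close>. This makes the region
  and its boundary line conditions on \<open>x\<close> alone.
\<close>

lemma above_line_iff:
  assumes "0 < R" and "0 < c" and "P (c * R) = R\<^sup>2"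
  shows "q * R / th \<le> c \<longleftrightarrow> 0 \<le> N (c * R)"
    and "c = q * R / th \<longleftrightarrow> N (c * R) = 0"
proof -
  define x where "x = c * R"
  have x: "0 < x"
    using assms by (simp add: x_def)
  have pos: "0 < th" "0 < A x"
    using ti_pos ti_less_th A_pos[OF x] by auto
  \<comment> \<open>Multiply \<open>c - q R / th\<close> by \<open>R\<close> and replace \<open>R\<^sup>2\<close> by \<open>P x\<close>.\<close>
  have "R * (c - q * R / th) = x - q * P x / th"
    using assms(3) by (simp add: x_def algebra_simps power2_eq_square)
  also have "\<dots> = x * (th * A x - x * B x) / (th * A x)"
    using pos q_pos by (simp add: P_def field_simps power2_eq_square)
  also have "th * A x - x * B x = N x"
    by (simp add: A_def B_def N_def algebra_simps)
  finally have "R * (c - q * R / th) / R = x * N x / (th * A x) / R"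
    by simp
  then have eq: "c - q * R / th = x / (R * (th * A x)) * N x"
    using assms(1) by (simp add: mult_ac)
  have k: "0 < x / (R * (th * A x))"
    using x assms(1) pos by simp
  have "0 \<le> c - q * R / th \<longleftrightarrow> 0 \<le> N x"
    unfolding eq using k zero_le_mult_iff[of "x / (R * (th * A x))" "N x"] by linarith
  moreover have "c - q * R / th = 0 \<longleftrightarrow> N x = 0"
    unfolding eq using k by (metis less_irrefl mult_eq_0_iff)
  ultimately show "q * R / th \<le> c \<longleftrightarrow> 0 \<le> N (c * R)" and "c = q * R / th \<longleftrightarrow> N (c * R) = 0"
    by (auto simp: x_def)
qed

text \<open>
  \<open>N' x = exp x * (th - ti - ti * x)\<close> changes sign once, at \<open>(th - ti) / ti\<close>: up to there \<open>N\<close>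
  increases from \<open>N 0 = 0\<close>, and then it decreases, reaching \<open>- th\<close> at \<open>th / ti\<close>.
\<close>

lemma N_sign:
  obtains x0 where "0 < x0" and "N x0 = 0"
    and "\<And>x. 0 < x \<Longrightarrow> x < x0 \<Longrightarrow> 0 < N x" and "\<And>x. x0 < x \<Longrightarrow> N x < 0"
proof -
  define m where "m = (th - ti) / ti"
  have m: "0 < m" "m < th / ti"
    using ti_pos ti_less_th by (auto simp: m_def field_simps)
  have N_deriv: "(N has_real_derivative exp x * ti * (m - x)) (at x)" for x
  proof -
    have "(N has_real_derivative exp x * (th - ti - ti * x)) (at x)"
      unfolding N_def[abs_def] by (auto intro!: derivative_eq_intros simp: algebra_simps)
    moreover have "th - ti - ti * x = ti * (m - x)"
      using ti_pos by (simp add: m_def right_diff_distrib[of _ "(th - ti) / ti"])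
    ultimately show ?thesis by (simp add: mult.assoc)
  qed
  have cont: "isCont N x" for x
    using N_deriv by (rule DERIV_isCont)
  have N_cont: "continuous_on {a..b} N" for a b
    using cont by (simp add: continuous_at_imp_continuous_on)
  have N_rise: "0 < N x" if "0 < x" "x \<le> m" for x
  proof -
    have "N 0 < N x"
      by (rule DERIV_pos_imp_increasing_open[OF that(1) _ N_cont])
         (use that ti_pos in \<open>auto intro!: exI N_deriv\<close>)
    then show ?thesis by (simp add: N_def)
  qed
  have N_fall: "N y < N x" if "m \<le> x" "x < y" for x y
    by (rule DERIV_neg_imp_decreasing_open[OF that(2) _ N_cont])
       (use that ti_pos in \<open>auto intro!: exI N_deriv simp: mult_pos_neg\<close>)
  have "N (th / ti) \<le> 0"
    using ti_pos ti_less_th by (simp add: N_def algebra_simps)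
  then obtain x0 where x0: "m \<le> x0" "N x0 = 0"
    using IVT2[of N "th / ti" 0 m] N_rise[of m] m cont by auto
  show thesis
  proof (rule that[of x0])
    show "0 < x0" "N x0 = 0"
      using m x0 by auto
    show "0 < N x" if "0 < x" "x < x0" for x
      using N_rise[of x] N_fall[of x x0] that x0 by (cases "x \<le> m") auto
    show "N x < 0" if "x0 < x" for x
      using N_fall[of x0 x] that x0 by simp
  qed
qed

section \<open>The curve\<close>

definition X :: "real \<Rightarrow> real" where "X R = inv_into {0<..} P (R\<^sup>2)"

definition curve :: "real \<Rightarrow> real" where "curve R = X R / R"

lemma X_eq: "0 < x \<Longrightarrow> P x = R\<^sup>2 \<Longrightarrow> X R = x"
  unfolding X_def by (metis P_inj greaterThan_iff inv_into_f_f)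

lemma X_deriv:
  assumes "0 < R" and "0 < X R" and "P (X R) = R\<^sup>2"
  shows "(X has_real_derivative 2 * X R * A (X R) * B (X R) / (W (X R) * R)) (at R)"
proof -
  define x where "x = X R"
  have x: "0 < x" "P x = R\<^sup>2"
    using assms by (auto simp: x_def)
  have pos: "0 < A x" "0 < W x"
    using A_pos W_pos x by auto
  have "(inv_into {0<..} P has_real_derivative inverse (x * W x / (q * (A x)\<^sup>2))) (at (P x))"
    by (rule inv_into_positive_has_derivative[OF P_deriv P_deriv_pos]) (use x in auto)
  then have "(inv_into {0<..} P has_real_derivative inverse (x * W x / (q * (A x)\<^sup>2))) (at (R\<^sup>2))"
    using x by simp
  moreover have "((\<lambda>R. R\<^sup>2) has_real_derivative 2 * R) (at R)"
    by (auto intro!: derivative_eq_intros)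
  ultimately have
    "(X has_real_derivative inverse (x * W x / (q * (A x)\<^sup>2)) * (2 * R)) (at R)"
    unfolding X_def[abs_def] by (rule DERIV_chain2)
  also have "inverse (x * W x / (q * (A x)\<^sup>2)) * (2 * R) = 2 * q * (A x)\<^sup>2 * R\<^sup>2 / (x * W x * R)"
    using assms(1) x pos by (simp add: field_simps power2_eq_square)
  \<comment> \<open>Replacing \<open>R\<^sup>2\<close> by \<open>P x\<close> eliminates \<open>q\<close> and makes the vanishing of \<open>curve'\<close> at a zero
     of \<open>N\<close> visible.\<close>
  also have "\<dots> = 2 * q * (A x)\<^sup>2 * P x / (x * W x * R)"
    using x by simp
  also have "\<dots> = 2 * x * A x * B x / (W x * R)"
    using x pos q_pos assms(1) by (simp add: P_def field_simps power2_eq_square)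
  finally show ?thesis
    by (simp add: x_def)
qed

text \<open>
  The numerator \<open>R * X' R - X R\<close> of the quotient rule is \<open>X * (2 * A * B - W) / W\<close>, and \<open>W\<close>
  differs from \<open>2 * A * B\<close> exactly by \<open>X * N\<close>.
\<close>

lemma curve_deriv:
  assumes "0 < R" and "0 < X R" and "P (X R) = R\<^sup>2"
  shows "(curve has_real_derivative - ((X R)\<^sup>2 * N (X R) / (W (X R) * R\<^sup>2))) (at R)"
proof -
  define x where "x = X R"
  have "0 < W x"
    using assms W_pos by (simp add: x_def)
  have "(curve has_real_derivative
      (2 * x * A x * B x / (W x * R) * R - x) / R\<^sup>2) (at R)"
    unfolding curve_def[abs_def] x_def power2_eq_square
    using DERIV_divide[OF X_deriv[OF assms] DERIV_ident] assms(1) by simp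
  also have "(2 * x * A x * B x / (W x * R) * R - x) / R\<^sup>2 = x * (2 * A x * B x - W x) / (W x * R\<^sup>2)"
    using \<open>0 < W x\<close> assms(1) by (simp add: field_simps)
  also have "2 * A x * B x - W x = - (x * N x)"
    by (simp add: W_def)
  finally show ?thesis
    by (simp add: x_def power2_eq_square algebra_simps)
qed

lemma curve_smooth_on:
  assumes X: "\<And>R. R \<in> S \<Longrightarrow> 0 < R \<and> 0 < X R \<and> P (X R) = R\<^sup>2"
  shows "smooth_on S curve"
proof -
  define gens where "gens = {\<lambda>R. R, X, \<lambda>R. exp (X R)}"
  define X' where "X' R = 2 * X R * A (X R) * B (X R) / (W (X R) * R)" for R
  have g: "(\<lambda>R. R) \<in> rational_closure S gens" "X \<in> rational_closure S gens"
    "(\<lambda>R. exp (X R)) \<in> rational_closure S gens"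
    by (auto simp: gens_def intro: rational_closure.gen)
  have nz: "R \<noteq> 0" "W (X R) \<noteq> 0" if "R \<in> S" for R
    using X[OF that] W_pos[of "X R"] by auto
  have X'_mem: "X' \<in> rational_closure S gens"
    unfolding X'_def[abs_def]
  proof (rule rational_closure_divide)
    show "(\<lambda>R. 2 * X R * A (X R) * B (X R)) \<in> rational_closure S gens"
      unfolding A_def B_def by (intro rational_closure_intros g)
    show "(\<lambda>R. W (X R) * R) \<in> rational_closure S gens"
      unfolding W_def A_def B_def N_def by (intro rational_closure_intros g)
  qed (use nz in auto)
  have dX: "(X has_real_derivative X' R) (at R within S)" if "R \<in> S" for R
    using X_deriv X[OF that] unfolding X'_def by (blast intro: has_field_derivative_at_within)
  show ?thesis
  proof (rule rational_closure_smooth_on)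
    fix h assume "h \<in> gens"
    then consider "h = (\<lambda>R. R)" | "h = X" | "h = (\<lambda>R. exp (X R))"
      unfolding gens_def by blast
    then show "\<exists>h' \<in> rational_closure S gens. \<forall>x\<in>S. (h has_real_derivative h' x) (at x within S)"
    proof cases
      case 1
      then show ?thesis
        by (intro bexI[of _ "\<lambda>_. 1"] rational_closure.const) auto
    next
      case 2
      then show ?thesis
        using X'_mem dX by blast
    next
      case 3
      then show ?thesis
        using dX
        by (intro bexI[of _ "\<lambda>R. exp (X R) * X' R"] rational_closure.mult g X'_mem)
           (auto intro!: derivative_eq_intros)
    qed
  next
    show "curve \<in> rational_closure S gens"
      unfolding curve_def[abs_def] by (intro rational_closure_divide g nz)
  qed
qed

text \<open>The only positive zero of \<open>P\<close>: the limit of \<open>X R\<close> as \<open>R\<close> tends to \<open>0\<close>.\<close>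
definition x_low :: real where "x_low = ln (th / ti)"

lemma x_low_pos: "0 < x_low"
  using ti_pos ti_less_th by (simp add: x_low_def)

lemma P_x_low: "P x_low = 0"
  using ti_pos ti_less_th by (simp add: P_def B_def x_low_def)

lemma P_pos_iff: "0 < x \<Longrightarrow> 0 < P x \<longleftrightarrow> x_low < x"
  using P_le_iff[of x x_low] x_low_pos P_x_low by auto

lemma X_solves:
  assumes "0 < R" and "R\<^sup>2 \<le> P x0" and "0 < x0"
  shows "x_low < X R" and "X R \<le> x0" and "P (X R) = R\<^sup>2"
proof -
  have "0 < R\<^sup>2"
    using assms(1) by simp
  then have "x_low < x0"
    using assms P_pos_iff[of x0] by linarith
  have "isCont P x" if "x_low \<le> x" for x
    using x_low_pos that by (intro DERIV_isCont[OF P_deriv]) simp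
  then obtain x where x: "x_low \<le> x" "x \<le> x0" "P x = R\<^sup>2"
    using IVT[of P x_low "R\<^sup>2" x0] \<open>x_low < x0\<close> assms(2) P_x_low by auto
  have "0 < x"
    using x(1) x_low_pos by simp
  then have "X R = x"
    using x(3) by (rule X_eq)
  then show "x_low < X R" "X R \<le> x0" "P (X R) = R\<^sup>2"
    using x \<open>0 < x\<close> \<open>0 < R\<^sup>2\<close> P_pos_iff[of x] by auto
qed

lemma level_set_is_graph:
  "\<exists>R0 c0 \<phi>.
    (R0, c0) \<in> Q_plus q th \<and> (R0, c0) \<in> line_Delta q th \<and> G q ti th R0 c0 = 0 \<and>
    {(R, c). (R, c) \<in> Q_plus q th \<and> G q ti th R c = 0} = {(R, \<phi> R) | R. R \<in> {0<..R0}} \<and>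
    smooth_on {0<..R0} \<phi> \<and>
    strict_antimono_on {0<..R0} \<phi> \<and>
    \<phi> R0 = c0 \<and>
    (\<phi> has_real_derivative 0) (at_left R0) \<and>
    filterlim \<phi> at_top (at_right 0)"
proof -
  obtain x0 where x0: "0 < x0" "N x0 = 0"
    and N_pos: "\<And>x. 0 < x \<Longrightarrow> x < x0 \<Longrightarrow> 0 < N x" and N_neg: "\<And>x. x0 < x \<Longrightarrow> N x < 0"
    using N_sign by blast
  have N_nonneg_iff: "0 \<le> N x \<longleftrightarrow> x \<le> x0" if "0 < x" for x
    using N_pos[of x] N_neg[of x] x0 that by (cases x x0 rule: linorder_cases) auto
  have th_pos: "0 < th"
    using ti_pos ti_less_th by simp
  have "x0 * B x0 = th * A x0"
    using x0(2) by (simp add: N_def A_def B_def algebra_simps)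
  then have "0 < B x0"
    using A_pos[OF x0(1)] th_pos x0(1) by (metis mult_pos_pos zero_less_mult_pos)
  then have Px0: "0 < P x0"
    using A_pos[OF x0(1)] q_pos x0(1) by (simp add: P_def)
  define R0 where "R0 = sqrt (P x0)"
  have R0: "0 < R0" "R0\<^sup>2 = P x0"
    using Px0 by (auto simp: R0_def)
  have sq_le: "R\<^sup>2 \<le> P x0 \<longleftrightarrow> R \<le> R0" if "0 < R" for R
    using that R0 by (metis less_eq_real_def power2_le_iff_abs_le abs_of_pos)
  have X: "x_low < X R" "0 < X R" "X R \<le> x0" "P (X R) = R\<^sup>2" if "R \<in> {0<..R0}" for R
    using X_solves[of R x0] that sq_le[of R] x0 x_low_pos by auto
  have X_R0: "X R0 = x0"
    using x0(1) R0(2) by (intro X_eq) auto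
  have curve_pos: "0 < curve R" if "R \<in> {0<..R0}" for R
    using that X(2)[OF that] by (simp add: curve_def)
  have curve_times: "curve R * R = X R" if "R \<in> {0<..R0}" for R
    using that by (simp add: curve_def)

  have level: "(R, c) \<in> Q_plus q th \<and> G q ti th R c = 0 \<longleftrightarrow> R \<in> {0<..R0} \<and> c = curve R" for R c
  proof
    assume "(R, c) \<in> Q_plus q th \<and> G q ti th R c = 0"
    then have R: "0 < R" and line: "q * R / th \<le> c" and G: "G q ti th R c = 0"
      by (auto simp: Q_plus_def)
    have "0 < q * R / th"
      using q_pos R th_pos by simp
    with line have c: "0 < c" by simp
    have x: "0 < c * R"
      using R c by simp
    have P: "P (c * R) = R\<^sup>2"
      using G G_eq_0_iff[OF R c] by simp
    have "c * R \<le> x0"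
      using above_line_iff(1)[OF R c P] line N_nonneg_iff[OF x] by simp
    then have "R\<^sup>2 \<le> P x0"
      using P P_le_iff[OF x x0(1)] by simp
    moreover have "X R = c * R"
      using x P by (rule X_eq)
    ultimately show "R \<in> {0<..R0} \<and> c = curve R"
      using R sq_le by (simp add: curve_def)
  next
    assume *: "R \<in> {0<..R0} \<and> c = curve R"
    then have mem: "R \<in> {0<..R0}" and R: "0 < R" and c: "0 < c" and x: "c * R = X R"
      using curve_pos curve_times by auto
    have P: "P (c * R) = R\<^sup>2"
      using X(4)[OF mem] x by simp
    have "q * R / th \<le> c"
      using above_line_iff(1)[OF R c P] N_nonneg_iff X(2,3)[OF mem] x by simp
    then show "(R, c) \<in> Q_plus q th \<and> G q ti th R c = 0"
      using R G_eq_0_iff[OF R c] P by (simp add: Q_plus_def)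
  qed

  have end_mem: "R0 \<in> {0<..R0}"
    using R0 by simp
  have end_line: "curve R0 = q * R0 / th"
    using above_line_iff(2)[OF R0(1) curve_pos[OF end_mem]] curve_times[OF end_mem] X_R0 R0(2) x0(2)
    by simp

  have deriv: "(curve has_real_derivative - ((X R)\<^sup>2 * N (X R) / (W (X R) * R\<^sup>2))) (at R)"
    if "R \<in> {0<..R0}" for R
    using that X[OF that] by (intro curve_deriv) auto
  \<comment> \<open>Before the endpoint \<open>X R < x0\<close>, where \<open>N\<close> is positive.\<close>
  have deriv_neg: "- ((X R)\<^sup>2 * N (X R) / (W (X R) * R\<^sup>2)) < 0" if "0 < R" "R < R0" for R
  proof -
    have mem: "R \<in> {0<..R0}"
      using that by simp
    have "X R \<noteq> x0"
      using X(4)[OF mem] sq_le[of R] that R0 by (metis less_le_not_le pos2 power_strict_mono)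
    then have "0 < N (X R)"
      using X(2,3)[OF mem] by (intro N_pos) auto
    then show ?thesis
      using X(2)[OF mem] W_pos[of "X R"] that by simp
  qed
  have antimono: "strict_antimono_on {0<..R0} curve"
  proof (rule monotone_onI)
    fix R S assume RS: "R \<in> {0<..R0}" "S \<in> {0<..R0}" "R < S"
    show "curve S < curve R"
    proof (rule DERIV_neg_imp_decreasing_open[OF \<open>R < S\<close>])
      show "\<exists>y. (curve has_real_derivative y) (at t) \<and> y < 0" if "R < t" "t < S" for t
        using that RS deriv[of t] deriv_neg[of t] by auto
      show "continuous_on {R..S} curve"
        using RS by (intro continuous_at_imp_continuous_on ballI DERIV_isCont[OF deriv]) auto
    qed
  qed
  have flat: "(curve has_real_derivative 0) (at_left R0)"
    using deriv[OF end_mem] X_R0 x0(2) by (auto intro: has_field_derivative_at_within)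

  \<comment> \<open>\<open>X R\<close> stays above \<open>x_low > 0\<close>, so \<open>X R / R\<close> is at least \<open>x_low / R\<close>.\<close>
  have "filterlim (\<lambda>R. x_low * inverse R) at_top (at_right 0)"
    by (rule filterlim_tendsto_pos_mult_at_top[OF tendsto_const x_low_pos
          filterlim_inverse_at_top_right])
  moreover have "eventually (\<lambda>R. x_low * inverse R \<le> curve R) (at_right 0)"
    unfolding eventually_at_right_field
  proof (intro exI[of _ R0] conjI allI impI)
    fix R assume "0 < R" "R < R0"
    then show "x_low * inverse R \<le> curve R"
      using X(1)[of R] by (simp add: curve_def divide_inverse)
  qed (use R0 in simp)
  ultimately have blow_up: "filterlim curve at_top (at_right 0)"
    by (rule filterlim_at_top_mono)

  show ?thesis
  proof (rule exI[of _ R0], rule exI[of _ "curve R0"], rule exI[of _ curve], intro conjI)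
    show "(R0, curve R0) \<in> Q_plus q th" "G q ti th R0 (curve R0) = 0"
      using level end_mem by auto
    show "(R0, curve R0) \<in> line_Delta q th"
      using end_line by (simp add: line_Delta_def)
    show "{(R, c). (R, c) \<in> Q_plus q th \<and> G q ti th R c = 0} = {(R, curve R) | R. R \<in> {0<..R0}}"
      using level by blast
    show "smooth_on {0<..R0} curve"
      using X by (intro curve_smooth_on) auto
  qed (use antimono flat blow_up in auto)
qed

end

theorem theorem2p2:
  fixes q \<theta>ig \<theta>hl :: real
  assumes "q > 0" and "0 < \<theta>ig" and "\<theta>ig < \<theta>hl"
  shows "\<exists>R0 c0 :: real. \<exists>\<phi> :: real \<Rightarrow> real.
    (R0, c0) \<in> Q_plus q \<theta>hl \<and> (R0, c0) \<in> line_Delta q \<theta>hl \<and> G q \<theta>ig \<theta>hl R0 c0 = 0 \<and>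
    {(R, c). (R, c) \<in> Q_plus q \<theta>hl \<and> G q \<theta>ig \<theta>hl R c = 0} = {(R, \<phi> R) | R. R \<in> {0<..R0}} \<and>
    smooth_on {0<..R0} \<phi> \<and>
    strict_antimono_on {0<..R0} \<phi> \<and>
    \<phi> R0 = c0 \<and>
    (\<phi> has_real_derivative 0) (at_left R0) \<and>
    filterlim \<phi> at_top (at_right 0)"
proof -
  interpret ignition q \<theta>ig \<theta>hl
    using assms by unfold_locales
  show ?thesis
    by (rule level_set_is_graph)
qed

end
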